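(* Let $H$ be a connected graph with weight function $\alpha:V_H\to[0,\infty)$ and total weight $A=\sum_{u\in V_H}\alpha(u)$, and let $\mathcal F$ be a finite family of pairwise disjoint connected graphs (disjoint also from $H$), each $K\in\mathcal F$ having a weight function $\beta_K:V_K\to[0,\infty)$ with total weight $B_K$ and a distinguished vertex $y_K\in V_K$. Let $K\mapsto x_K$ be a map $\mathcal F\to V_H$, and for $x\in V_H$ let $\mathcal F_x=\{K\in\mathcal F: x_K=x\}$. Let $G=(V,E)$ be the graph obtained from the disjoint union of $H$ and all $K\in\mathcal F$ by identifying, for every $K\in\mathcal F$, the vertex $y_K$ with $x_K$, and give it the weight function $\gamma=\alpha+\sum_{K\in\mathcal F}\beta_K$. Put $n_x=\sum_{K\in\mathcal F_x}|V_K|-|\mathcal F_x|+1$, $w_x=\sum_{K\in\mathcal F_x}B_K$ for $x\in V_H$, and $W=A+\sum_{K\in\mathcal F}B_K$. Let $\mathbf j,\mathbf n,\mathbf w$ be the column vectors indexed by $V_H$ with components $1$, $n_x$, $w_x$ respectively, and let $\mathbf D$ be the distance matrix of $H$, $(\mathbf D)_{xx'}=\operatorname{dist}_H(x,x')$. Then $$ M_{G}^{\gamma}=M_H^{\alpha}+\sum_{K\in\mathcal F}M_{K}^{\beta_K}+\sum_{x\in V_H}M_{H}^{\xi_x}(x)+\sum_{K\in\mathcal F}M_{K}^{\eta_K}(y_K)+(\mathbf n-\mathbf j)^{\top}\mathbf D\,\mathbf w, $$ where $\xi_x=(n_x-1)\alpha+w_x$ (a function on $V_H$) and $\eta_K=(|V|-|V_K|)\beta_K+W-B_K$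 (a function on $V_K$).
   Context: For a connected graph $G$ with vertex set $V$, distance function $\operatorname{dist}$, and a function $\rho:V\to\mathbb{R}$, the $\rho$-moment of $G$ at $u$ is $M_G^{\rho}(u)=\sum_{v\in V}\rho(v)\operatorname{dist}(v,u)$ and the $\rho$-moment of $G$ is $M_G^{\rho}=\sum_{u\in V}M_G^{\rho}(u)$. The weight function $\gamma$ is $\gamma(v)=\alpha(v)+\sum_{K\in\mathcal F_v}\beta_K(y_K)$ for $v\in V_H$, and $\gamma(z)=\beta_K(z)$ for $z\in V_K\setminus\{y_K\}$. Note $|V|=\sum_{x\in V_H}n_x$ (with $n_x=1$ if $\mathcal F_x=\emptyset$). *)

theory Defs
  imports "Graph_Theory.Graph_Theory" "HOL-Library.Disjoint_Sets"
begin

text \<open>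
  A finite simple graph is a \<^typ>\<open>'a pair_pre_digraph\<close> satisfying \<^const>\<open>pair_graph\<close>:
  every undirected edge is represented by its two opposite arcs. All graphs share one vertex
  type, so that disjointness is disjointness of vertex sets.
\<close>

text \<open>
  The library's shortest-path function with unit arc costs; it is finite on connected graphs,
  the only ones for which the real number below is meaningful.
\<close>
definition graph_dist :: "'a pair_pre_digraph \<Rightarrow> 'a \<Rightarrow> 'a \<Rightarrow> real" where
  "graph_dist G u v = real_of_ereal (wf_digraph.\<mu> (with_proj G) (\<lambda>_. 1) u v)"

definition moment_at :: "'a pair_pre_digraph \<Rightarrow> ('a \<Rightarrow> real) \<Rightarrow> 'a \<Rightarrow> real" where
  "moment_at G \<rho> u = (\<Sum>v\<in>pverts G. \<rho> v * graph_dist G v u)"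

definition moment :: "'a pair_pre_digraph \<Rightarrow> ('a \<Rightarrow> real) \<Rightarrow> real" where
  "moment G \<rho> = (\<Sum>u\<in>pverts G. moment_at G \<rho> u)"

text \<open>
  In the glued graph the vertex obtained by identifying \<open>y K\<close> with \<open>x K\<close> is called \<open>x K\<close>. For
  disjoint graphs its vertex set is therefore \<open>V\<^sub>H\<close> together with all \<open>V\<^sub>K - {y K}\<close>.
\<close>
definition relocate ::
  "('a pair_pre_digraph \<Rightarrow> 'a) \<Rightarrow> ('a pair_pre_digraph \<Rightarrow> 'a) \<Rightarrow> 'a pair_pre_digraph \<Rightarrow> 'a \<Rightarrow> 'a"
where
  "relocate x y K = id(y K := x K)"

definition glue ::
  "'a pair_pre_digraph \<Rightarrow> 'a pair_pre_digraph set \<Rightarrow> ('a pair_pre_digraph \<Rightarrow> 'a) \<Rightarrow>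
   ('a pair_pre_digraph \<Rightarrow> 'a) \<Rightarrow> 'a pair_pre_digraph"
where
  "glue H F x y =
     \<lparr> pverts = pverts H \<union> (\<Union>K\<in>F. relocate x y K ` pverts K),
       parcs = parcs H \<union> (\<Union>K\<in>F. map_prod (relocate x y K) (relocate x y K) ` parcs K) \<rparr>"

definition attached :: "'a pair_pre_digraph set \<Rightarrow> ('a pair_pre_digraph \<Rightarrow> 'a) \<Rightarrow> 'a \<Rightarrow>
   'a pair_pre_digraph set"
where
  "attached F x v = {K \<in> F. x K = v}"

definition glue_weight ::
  "'a pair_pre_digraph \<Rightarrow> 'a pair_pre_digraph set \<Rightarrow> ('a pair_pre_digraph \<Rightarrow> 'a) \<Rightarrow>
   ('a pair_pre_digraph \<Rightarrow> 'a) \<Rightarrow> ('a \<Rightarrow> real) \<Rightarrow> ('a pair_pre_digraph \<Rightarrow> 'a \<Rightarrow> real) \<Rightarrow> 'a \<Rightarrow> real"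
where
  "glue_weight H F x y \<alpha> \<beta> v =
     (if v \<in> pverts H then \<alpha> v + (\<Sum>K\<in>attached F x v. \<beta> K (y K))
      else \<beta> (THE K. K \<in> F \<and> v \<in> pverts K) v)"

text \<open>
  Column vectors and matrices indexed by a vertex set \<open>S\<close> are functions, of which only the values
  on \<open>S\<close> matter.
\<close>
definition dot_on :: "'a set \<Rightarrow> ('a \<Rightarrow> real) \<Rightarrow> ('a \<Rightarrow> real) \<Rightarrow> real" where
  "dot_on S a b = (\<Sum>s\<in>S. a s * b s)"

definition mat_vec_on :: "'a set \<Rightarrow> ('a \<Rightarrow> 'a \<Rightarrow> real) \<Rightarrow> ('a \<Rightarrow> real) \<Rightarrow> 'a \<Rightarrow> real" where
  "mat_vec_on S M a s = (\<Sum>t\<in>S. M s t * a t)"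

end

(*
  Glued copies meet the rest of G only in cut vertices: a shortest path leaving the copy of K
  passes through x_K, so d(p, v) = d_K(p, y_K) + d(x_K, v) for p in K and v outside the copy, while
  distances inside H and inside each copy are unchanged. Lower bounds on distances are obtained
  without looking at paths, because f(v) - f(u) <= d(u, v) whenever f grows by at most 1 along
  every arc. Summing over v turns the distance sum of G at p into
    sum_q d_K(p, q) + (|V| - |V_K|) d_K(p, y_K) + (distance sum of G at x_K) - M_K^1(y_K),
  and weighting with gamma and collecting terms gives the formula.
*)
theory Submission
  imports Defs
begin

section \<open>Distances in connected symmetric digraphs\<close>

locale connected_sym_digraph = pair_sym_digraph +
  assumes reach: "u \<in> pverts G \<Longrightarrow> v \<in> pverts G \<Longrightarrow> u \<rightarrow>\<^sup>*\<^bsub>with_proj G\<^esub> v"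
begin

lemma adjacent_sym: "(u, v) \<in> parcs G \<Longrightarrow> (v, u) \<in> parcs G"
  using arcs_symmetric by blast

text \<open>Walk costs are lengths, hence natural numbers, so the infimum defining
  \<open>\<mu>\<close> is a minimum as soon as some walk exists. The extended-real definition is
  opened only here.\<close>

lemma graph_dist_le_length:
  assumes "awalk u p v" shows "graph_dist G u v \<le> length p"
    and graph_dist_attained: "\<exists>q. awalk u q v \<and> graph_dist G u v = length q"
proof -
  have cost: "awalk_cost (\<lambda>_. 1) q = length q" for q
    by (simp add: awalk_cost_def sum_list_triv)
  define P where "P = (\<lambda>k. \<exists>q. awalk u q v \<and> length q = k)"
  have "P (Least P)" using assms by (intro LeastI[of P "length p"]) (auto simp: P_def)
  then obtain q where q: "awalk u q v" "length q = Least P" by (auto simp: P_def)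
  have least: "length q \<le> length q'" if "awalk u q' v" for q'
    using that by (auto simp: q(2) P_def intro: Least_le)
  have "\<mu> (\<lambda>_. 1) u v = ereal (length q)"
    unfolding \<mu>_def cost by (rule INF_eqI) (use q(1) least in auto)
  then have eq: "graph_dist G u v = length q" by (simp add: graph_dist_def)
  show "graph_dist G u v \<le> length p" using eq least[OF assms] by simp
  show "\<exists>q. awalk u q v \<and> graph_dist G u v = length q" using eq q by blast
qed

lemma shortest_walk:
  assumes "u \<in> pverts G" "v \<in> pverts G"
  obtains p where "awalk u p v" "graph_dist G u v = length p"
  using reach[OF assms] graph_dist_attained unfolding reachable_awalk by blast

lemma graph_dist_self: "u \<in> pverts G \<Longrightarrow> graph_dist G u u = 0"
  using graph_dist_le_length[of u "[]" u] graph_dist_attained[of u "[]" u]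
  by (auto simp: awalk_Nil_iff)

lemma graph_dist_triangle:
  assumes "u \<in> pverts G" "v \<in> pverts G" "w \<in> pverts G"
  shows "graph_dist G u w \<le> graph_dist G u v + graph_dist G v w"
proof -
  obtain p q where "awalk u p v" "graph_dist G u v = length p"
    "awalk v q w" "graph_dist G v w = length q"
    using shortest_walk assms by metis
  then show ?thesis using graph_dist_le_length[OF awalk_appendI, of u p v q w] by simp
qed

lemma graph_dist_arc: "(u, v) \<in> parcs G \<Longrightarrow> graph_dist G u v \<le> 1"
  using graph_dist_le_length[of u "[(u, v)]" v] wellformed' by (simp add: awalk_simps)

text \<open>Both arcs of an edge are present, so the one-sided bound makes \<open>f\<close> change
  by at most 1 along every edge.\<close>

definition lipschitz :: "('a \<Rightarrow> real) \<Rightarrow> bool" where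
  "lipschitz f \<longleftrightarrow> (\<forall>u v. (u, v) \<in> parcs G \<longrightarrow> f v \<le> f u + 1)"

text \<open>Each arc of a shortest walk contributes at most 1. It is used in both directions below:
  with hand-made potentials for lower bounds on distances in the glued graph, and with its distance
  function pulled back to a piece for upper bounds.\<close>

lemma lipschitz_le_graph_dist:
  assumes "lipschitz f" "u \<in> pverts G" "v \<in> pverts G"
  shows "f v - f u \<le> graph_dist G u v"
proof -
  have "f v - f u \<le> length p" if "awalk u p v" for p
    using that
  proof (induction p arbitrary: u)
    case Nil
    then show ?case by (simp add: awalk_Nil_iff)
  next
    case (Cons e p)
    then have "e \<in> parcs G" "fst e = u" "f v - f (snd e) \<le> length p"
      by (auto simp: awalk_Cons_iff)
    moreover from this have "f (snd e) \<le> f u + 1"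
      using assms(1) by (cases e) (auto simp: lipschitz_def)
    ultimately show ?case by simp
  qed
  then show ?thesis using shortest_walk[OF assms(2,3)] by metis
qed

lemma lipschitz_graph_dist: "w \<in> pverts G \<Longrightarrow> lipschitz (graph_dist G w)"
  unfolding lipschitz_def
  by (meson add_left_mono graph_dist_arc graph_dist_triangle order_trans wellformed')

text \<open>No walk is reversed: the distance to \<open>v\<close> is itself Lipschitz, since each
  arc has a reverse, and comparing its values at \<open>u\<close> and \<open>v\<close> gives one
  inequality for arbitrary vertices.\<close>

lemma graph_dist_sym:
  assumes "u \<in> pverts G" "v \<in> pverts G"
  shows "graph_dist G u v = graph_dist G v u"
proof -
  have le: "graph_dist G u v \<le> graph_dist G v u" if "u \<in> pverts G" "v \<in> pverts G" for u v
  proof -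
    have "graph_dist G b v \<le> graph_dist G a v + 1" if ab: "(a, b) \<in> parcs G" for a b
      using graph_dist_triangle[of b a v] graph_dist_arc[OF adjacent_sym[OF ab]]
        wellformed'[OF ab] \<open>v \<in> pverts G\<close> by simp
    then have "lipschitz (\<lambda>w. graph_dist G w v)" by (simp add: lipschitz_def)
    from lipschitz_le_graph_dist[OF this that(2,1)] show ?thesis
      using graph_dist_self that by simp
  qed
  show ?thesis using le[OF assms] le[OF assms(2,1)] by simp
qed

end

section \<open>The glued graph and its connectedness\<close>

lemma connected_sym_digraphI:
  assumes "pair_graph G" "Digraph_Component.connected (with_proj G)"
  shows "connected_sym_digraph G"
proof -
  interpret pair_graph G by fact
  show ?thesis
    using symmetric_connected_imp_strongly_connected[OF pair_sym_arcs assms(2)]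
    by unfold_locales (auto simp: strongly_connected_def)
qed

text \<open>Transfers connectedness of the pieces to the glued graph, with \<open>h\<close> the
  identity on \<open>H\<close> or the relocation on \<open>K\<close>.\<close>

lemma reachable_hom:
  assumes G: "pair_wf_digraph G'" and K: "connected_sym_digraph K"
    and arc: "\<And>p q. (p, q) \<in> parcs K \<Longrightarrow> (h p, h q) \<in> parcs G'"
    and vert: "\<And>p. p \<in> pverts K \<Longrightarrow> h p \<in> pverts G'"
    and "p \<in> pverts K" "q \<in> pverts K"
  shows "h p \<rightarrow>\<^sup>*\<^bsub>with_proj G'\<^esub> h q"
proof -
  interpret K: connected_sym_digraph K by fact
  interpret G: pair_wf_digraph G' by fact
  show ?thesis using K.reach[OF assms(5,6)]
  proof (induction rule: K.reachable_induct)
    case base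
    then show ?case using vert assms(5) by simp
  next
    case (step v w)
    then have "(h v, h w) \<in> parcs G'" using arc by simp
    with step.IH show ?case by (rule G.reachable_adj_trans)
  qed
qed

locale gluing =
  fixes H :: "'a pair_pre_digraph" and F :: "'a pair_pre_digraph set"
    and x y :: "'a pair_pre_digraph \<Rightarrow> 'a"
  assumes H: "connected_sym_digraph H" "finite (pverts H)"
    and F: "finite F" "\<And>K. K \<in> F \<Longrightarrow> connected_sym_digraph K"
      "\<And>K. K \<in> F \<Longrightarrow> finite (pverts K)"
    and disjoint: "disjoint_family_on pverts F" "\<And>K. K \<in> F \<Longrightarrow> pverts K \<inter> pverts H = {}"
    and y_in: "\<And>K. K \<in> F \<Longrightarrow> y K \<in> pverts K"
    and x_in: "\<And>K. K \<in> F \<Longrightarrow> x K \<in> pverts H"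
begin

abbreviation G :: "'a pair_pre_digraph" where "G \<equiv> glue H F x y"

abbreviation r :: "'a pair_pre_digraph \<Rightarrow> 'a \<Rightarrow> 'a" where "r \<equiv> relocate x y"

lemma relocate_base [simp]: "r K (y K) = x K"
  by (simp add: relocate_def)

text \<open>Disjointness of the family resolves the description in \<open>glue_weight\<close> and in
  \<open>amalg\<close>.\<close>

lemma the_owner: "K \<in> F \<Longrightarrow> p \<in> pverts K \<Longrightarrow> (THE K. K \<in> F \<and> p \<in> pverts K) = K"
  using disjoint(1) by (intro the_equality) (auto simp: disjoint_family_on_def)

lemma notin_H: "K \<in> F \<Longrightarrow> p \<in> pverts K \<Longrightarrow> p \<notin> pverts H"
  using disjoint(2) by blast

lemma pverts_H_subset: "pverts H \<subseteq> pverts G"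
  and relocate_in: "K \<in> F \<Longrightarrow> p \<in> pverts K \<Longrightarrow> r K p \<in> pverts G"
  and parcs_H_subset: "parcs H \<subseteq> parcs G"
  and relocate_arc: "K \<in> F \<Longrightarrow> (p, q) \<in> parcs K \<Longrightarrow> (r K p, r K q) \<in> parcs G"
  by (auto simp: glue_def)

lemma base_in: "K \<in> F \<Longrightarrow> x K \<in> pverts G"
  using pverts_H_subset x_in by blast

lemma arc_cases:
  assumes "(u, v) \<in> parcs G"
  obtains "(u, v) \<in> parcs H"
    | K p q where "K \<in> F" "(p, q) \<in> parcs K" "u = r K p" "v = r K q"
  using assms by (auto simp: glue_def)

lemma vert_cases:
  assumes "u \<in> pverts G"
  obtains "u \<in> pverts H" | K p where "K \<in> F" "p \<in> pverts K" "u = r K p"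
  using assms by (auto simp: glue_def)

text \<open>\<open>H\<close> serves as a hub: a vertex of the copy of \<open>K\<close> and
  \<open>x K\<close> reach each other inside that copy, and vertices of \<open>H\<close> reach each
  other inside \<open>H\<close>.\<close>

lemma connected_G: "connected_sym_digraph G"
proof -
  interpret H: connected_sym_digraph H by (rule H)
  have wf: "pair_wf_digraph G"
  proof
    have "u \<in> pverts G \<and> v \<in> pverts G" if "(u, v) \<in> parcs G" for u v
      using that
    proof (cases rule: arc_cases)
      case 1
      then show ?thesis using H.wellformed' pverts_H_subset by blast
    next
      case (2 K p q)
      interpret K: connected_sym_digraph K by (rule F(2)[OF 2(1)])
      show ?thesis using 2 relocate_in K.wellformed' by blast
    qed
    then show "fst e \<in> pverts G" "snd e \<in> pverts G" if "e \<in> parcs G" for e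
      using that by (cases e; simp)+
  qed
  interpret G: pair_wf_digraph G by (rule wf)
  have sym: "(v, u) \<in> parcs G" if "(u, v) \<in> parcs G" for u v
    using that
  proof (cases rule: arc_cases)
    case 1
    then show ?thesis using H.adjacent_sym parcs_H_subset by blast
  next
    case (2 K p q)
    interpret K: connected_sym_digraph K by (rule F(2)[OF 2(1)])
    show ?thesis using 2 relocate_arc K.adjacent_sym by blast
  qed
  have reach_H: "u \<rightarrow>\<^sup>*\<^bsub>with_proj G\<^esub> v" if "u \<in> pverts H" "v \<in> pverts H" for u v
    using reachable_hom[OF wf H(1), of "\<lambda>p. p" u v] that parcs_H_subset pverts_H_subset by blast
  have "\<exists>h\<in>pverts H. u \<rightarrow>\<^sup>*\<^bsub>with_proj G\<^esub> h \<and> h \<rightarrow>\<^sup>*\<^bsub>with_proj G\<^esub> u" if "u \<in> pverts G" for u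
    using that
  proof (cases rule: vert_cases)
    case 1
    then show ?thesis using reach_H by blast
  next
    case (2 K p)
    then show ?thesis
      using reachable_hom[OF wf F(2), of K "r K" p "y K"] reachable_hom[OF wf F(2), of K "r K" "y K" p]
        relocate_arc relocate_in y_in x_in by auto
  qed
  then have "u \<rightarrow>\<^sup>*\<^bsub>with_proj G\<^esub> v" if "u \<in> pverts G" "v \<in> pverts G" for u v
    using that reach_H by (meson G.reachable_trans)
  then show ?thesis
    using sym by unfold_locales (auto simp: symmetric_def intro: symI)
qed

sublocale H: connected_sym_digraph H by (rule H)
sublocale G: connected_sym_digraph G by (rule connected_G)

section \<open>Potentials and distances in the glued graph\<close>

text \<open>A merged vertex takes its value from \<open>fH\<close>; the choice is harmless once
  \<open>fK K (y K) = fH (x K)\<close>, the compatibility condition of the next lemmas.\<close>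

definition amalg :: "('a \<Rightarrow> 'b) \<Rightarrow> ('a pair_pre_digraph \<Rightarrow> 'a \<Rightarrow> 'b) \<Rightarrow> 'a \<Rightarrow> 'b" where
  "amalg fH fK u = (if u \<in> pverts H then fH u else fK (THE K. K \<in> F \<and> u \<in> pverts K) u)"

lemma amalg_H: "u \<in> pverts H \<Longrightarrow> amalg fH fK u = fH u"
  by (simp add: amalg_def)

lemma amalg_relocate:
  assumes "K \<in> F" "p \<in> pverts K" "fK K (y K) = fH (x K)"
  shows "amalg fH fK (r K p) = fK K p"
  using assms the_owner notin_H x_in by (auto simp: amalg_def relocate_def)

text \<open>Every arc of the glued graph is the image of an arc of a single piece, so the condition
  can be checked piece by piece.\<close>

lemma lipschitz_amalg:
  assumes "H.lipschitz fH"
    and "\<And>K. K \<in> F \<Longrightarrow> connected_sym_digraph.lipschitz K (fK K)"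
    and compat: "\<And>K. K \<in> F \<Longrightarrow> fK K (y K) = fH (x K)"
  shows "G.lipschitz (amalg fH fK)"
  unfolding G.lipschitz_def
proof safe
  fix u v assume "(u, v) \<in> parcs G"
  then show "amalg fH fK v \<le> amalg fH fK u + 1"
  proof (cases rule: arc_cases)
    case 1
    then show ?thesis using assms(1) H.wellformed' by (simp add: H.lipschitz_def amalg_H)
  next
    case (2 K p q)
    interpret K: connected_sym_digraph K by (rule F(2)[OF 2(1)])
    show ?thesis using 2 assms(2)[OF 2(1)] K.wellformed'[OF 2(2)]
      by (simp add: K.lipschitz_def amalg_relocate compat)
  qed
qed

lemma lipschitz_restrict_H: "G.lipschitz f \<Longrightarrow> H.lipschitz f"
  using parcs_H_subset by (auto simp: G.lipschitz_def H.lipschitz_def)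

lemma lipschitz_restrict:
  assumes "G.lipschitz f" "K \<in> F"
  shows "connected_sym_digraph.lipschitz K (\<lambda>p. f (r K p))"
proof -
  interpret K: connected_sym_digraph K by (rule F(2)[OF assms(2)])
  show ?thesis using assms relocate_arc by (auto simp: G.lipschitz_def K.lipschitz_def)
qed

lemma dist_H:
  assumes "u \<in> pverts H" "v \<in> pverts H"
  shows "graph_dist G u v = graph_dist H u v"
proof (rule antisym)
  have in_G: "u \<in> pverts G" "v \<in> pverts G" using assms pverts_H_subset by auto
  \<comment> \<open>The distance from \<open>u\<close> in the glued graph, restricted to
    \<open>H\<close>, is Lipschitz on \<open>H\<close>.\<close>
  show "graph_dist G u v \<le> graph_dist H u v"
    using H.lipschitz_le_graph_dist[OF lipschitz_restrict_H[OF G.lipschitz_graph_dist] assms, of u]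
      in_G G.graph_dist_self by simp
  \<comment> \<open>Collapse every copy to its cut vertex: the potential is constant on each
    \<open>K\<close>.\<close>
  let ?f = "amalg (graph_dist H u) (\<lambda>K p. graph_dist H u (x K))"
  have "G.lipschitz ?f"
  proof (rule lipschitz_amalg)
    fix K assume "K \<in> F"
    then interpret K: connected_sym_digraph K by (rule F(2))
    show "K.lipschitz (\<lambda>p. graph_dist H u (x K))" by (simp add: K.lipschitz_def)
  qed (use H.lipschitz_graph_dist assms in auto)
  from G.lipschitz_le_graph_dist[OF this in_G]
  show "graph_dist H u v \<le> graph_dist G u v"
    using assms by (simp add: amalg_H H.graph_dist_self)
qed

text \<open>
  The lower bounds come from a single potential: \<open>graph_dist K p\<close> on the glued copy of \<open>K\<close>,
  continued past the cut vertex \<open>x K\<close> by the distance from \<open>x K\<close>.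
\<close>
lemma
  assumes K: "K \<in> F" and p: "p \<in> pverts K"
  shows dist_relocate: "\<And>q. q \<in> pverts K \<Longrightarrow> graph_dist G (r K p) (r K q) = graph_dist K p q"
    and dist_cut: "\<And>v. v \<in> pverts G - r K ` pverts K \<Longrightarrow>
      graph_dist G (r K p) v = graph_dist K p (y K) + graph_dist G (x K) v"
proof -
  interpret K: connected_sym_digraph K by (rule F(2)[OF K])
  let ?c = "graph_dist K p (y K)"
  define fH where "fH v = ?c + graph_dist G (x K) v" for v
  \<comment> \<open>\<open>fH\<close> uses the distance of the whole glued graph, so on copies other
    than \<open>K\<close> it can simply be pulled back.\<close>
  define fK where "fK L q = (if L = K then graph_dist K p q else fH (r L q))" for L q
  let ?f = "amalg fH fK"
  \<comment> \<open>For \<open>L = K\<close> both sides equal \<open>?c\<close>, as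
    \<open>x K\<close> has distance 0 from itself.\<close>
  have compat: "fK L (y L) = fH (x L)" if "L \<in> F" for L
    using that base_in[OF K] by (simp add: fH_def fK_def G.graph_dist_self)
  have lip: "G.lipschitz fH"
    using G.lipschitz_graph_dist[OF base_in[OF K]] by (simp add: fH_def G.lipschitz_def)
  have "G.lipschitz ?f"
  proof (rule lipschitz_amalg)
    show "H.lipschitz fH" using lip by (rule lipschitz_restrict_H)
    show "connected_sym_digraph.lipschitz L (fK L)" if "L \<in> F" for L
    proof (cases "L = K")
      case True
      then have "fK L = graph_dist K p" by (auto simp: fK_def)
      then show ?thesis using True K.lipschitz_graph_dist[OF p] by simp
    next
      case False
      then have "fK L = (\<lambda>q. fH (r L q))" by (auto simp: fK_def)
      then show ?thesis using lipschitz_restrict[OF lip that] by simp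
    qed
  qed (rule compat)
  note lower = G.lipschitz_le_graph_dist[OF this relocate_in[OF K p]]
  have f_in: "?f (r K q) = graph_dist K p q" if "q \<in> pverts K" for q
    using amalg_relocate[OF K that, of fK fH] compat[OF K] by (simp add: fK_def)
  \<comment> \<open>The potential starts at 0, so its value at any vertex is a lower bound for the
    distance from \<open>r K p\<close>.\<close>
  have f_p: "?f (r K p) = 0" using p f_in K.graph_dist_self by simp
  show rel: "graph_dist G (r K p) (r K q) = graph_dist K p q" if q: "q \<in> pverts K" for q
  proof (rule antisym)
    show "graph_dist G (r K p) (r K q) \<le> graph_dist K p q"
      using K.lipschitz_le_graph_dist[OF lipschitz_restrict[OF G.lipschitz_graph_dist K] p q, of "r K p"]
        relocate_in[OF K p] G.graph_dist_self by simp
    show "graph_dist K p q \<le> graph_dist G (r K p) (r K q)"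
      using lower[OF relocate_in[OF K q]] f_in[OF q] f_p by simp
  qed
  show "graph_dist G (r K p) v = ?c + graph_dist G (x K) v" if v: "v \<in> pverts G - r K ` pverts K" for v
  proof (rule antisym)
    \<comment> \<open>Triangle inequality through \<open>x K = r K (y K)\<close>; \<open>rel\<close>
      evaluates the first leg.\<close>
    show "graph_dist G (r K p) v \<le> ?c + graph_dist G (x K) v"
      using G.graph_dist_triangle[OF relocate_in[OF K p] base_in[OF K], of v] v
        rel[OF y_in[OF K]] by simp
    have "v \<in> pverts G" using v by simp
    then have "?f v = fH v"
    proof (cases rule: vert_cases)
      case 1
      then show ?thesis by (rule amalg_H)
    next
      case (2 L q)
      then have "L \<noteq> K" using v by auto
      then show ?thesis
        using amalg_relocate[OF 2(1,2), of fK fH] compat[OF 2(1)] 2(3) by (simp add: fK_def)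
    qed
    then show "?c + graph_dist G (x K) v \<le> graph_dist G (r K p) v"
      using lower[of v] f_p v by (simp add: fH_def)
  qed
qed

section \<open>Sums over the glued graph\<close>

text \<open>\<open>x K\<close> lies in \<open>H\<close>, hence outside \<open>K\<close>, so moving
  \<open>y K\<close> there causes no collision.\<close>

lemma inj_relocate: "K \<in> F \<Longrightarrow> inj_on (r K) (pverts K)"
  using x_in notin_H by (fastforce simp: inj_on_def relocate_def)

lemma finite_G: "finite (pverts G)"
  using H F by (auto simp: glue_def)

lemma pverts_glue: "pverts G = pverts H \<union> (\<Union>K\<in>F. pverts K - {y K})"
proof -
  have "r K ` pverts K = insert (x K) (pverts K - {y K})" if "K \<in> F" for K
    using y_in[OF that] by (auto simp: relocate_def image_iff)
  then show ?thesis using x_in by (fastforce simp: glue_def)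
qed

text \<open>The merged vertex is already counted in \<open>H\<close>; subtracting
  \<open>g (x K)\<close> instead of deleting \<open>y K\<close> lets the inner sums run over all of
  \<open>K\<close>.\<close>

lemma sum_glue:
  fixes g :: "'a \<Rightarrow> real"
  shows "sum g (pverts G) = sum g (pverts H) + (\<Sum>K\<in>F. (\<Sum>p\<in>pverts K. g (r K p)) - g (x K))"
proof -
  have K: "sum g (pverts K - {y K}) = (\<Sum>p\<in>pverts K. g (r K p)) - g (x K)" if "K \<in> F" for K
  proof -
    have "(\<Sum>p\<in>pverts K. g (r K p)) = g (x K) + (\<Sum>p\<in>pverts K - {y K}. g (r K p))"
      using F(3)[OF that] y_in[OF that] by (simp add: sum.remove)
    also have "(\<Sum>p\<in>pverts K - {y K}. g (r K p)) = sum g (pverts K - {y K})"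
      by (rule sum.cong) (auto simp: relocate_def)
    finally show ?thesis by simp
  qed
  have "sum g (pverts G) = sum g (pverts H) + sum g (\<Union>K\<in>F. pverts K - {y K})"
    unfolding pverts_glue by (rule sum.union_disjoint) (use H F disjoint in auto)
  also have "sum g (\<Union>K\<in>F. pverts K - {y K}) = (\<Sum>K\<in>F. sum g (pverts K - {y K}))"
    by (rule sum.UNION_disjoint) (use F disjoint(1) in \<open>fastforce simp: disjoint_family_on_def\<close>)+
  finally show ?thesis using K by simp
qed

lemma sum_attached:
  fixes g :: "'a pair_pre_digraph \<Rightarrow> real"
  shows "(\<Sum>v\<in>pverts H. \<Sum>K\<in>attached F x v. g K) = sum g F"
  unfolding attached_def using F(1) H(2) x_in by (intro sum.group) auto

text \<open>The sets \<open>attached F x v\<close> are the fibres of \<open>x\<close>, and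
  \<open>v = x K\<close> on a fibre. This turns sums over \<open>H\<close> involving
  \<open>n\<close> and \<open>w\<close> into sums over \<open>F\<close>.\<close>

lemma sum_attached_mult:
  fixes g :: "'a pair_pre_digraph \<Rightarrow> real"
  shows "(\<Sum>v\<in>pverts H. (\<Sum>K\<in>attached F x v. g K) * h v) = (\<Sum>K\<in>F. g K * h (x K))"
proof -
  have "(\<Sum>v\<in>pverts H. (\<Sum>K\<in>attached F x v. g K) * h v) =
    (\<Sum>v\<in>pverts H. \<Sum>K\<in>attached F x v. g K * h (x K))"
    by (auto simp: sum_distrib_right attached_def intro!: sum.cong)
  then show ?thesis by (simp add: sum_attached)
qed

text \<open>The extra mass \<open>\<beta> K (y K)\<close> placed at \<open>x K\<close> is exactly
  what the sum over \<open>K\<close> without \<open>y K\<close> lacks.\<close>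

lemma sum_glue_weight:
  "(\<Sum>v\<in>pverts G. glue_weight H F x y \<alpha> \<beta> v * g v) =
    (\<Sum>v\<in>pverts H. \<alpha> v * g v) + (\<Sum>K\<in>F. \<Sum>p\<in>pverts K. \<beta> K p * g (r K p))"
proof -
  let ?\<gamma> = "glue_weight H F x y \<alpha> \<beta>"
  \<comment> \<open>On both sides the term at \<open>y K\<close> cancels, leaving sums over the
    vertices that keep their names.\<close>
  have "(\<Sum>p\<in>pverts K. ?\<gamma> (r K p) * g (r K p)) - ?\<gamma> (x K) * g (x K) =
      (\<Sum>p\<in>pverts K. \<beta> K p * g (r K p)) - \<beta> K (y K) * g (x K)" if K: "K \<in> F" for K
  proof -
    have "(\<Sum>p\<in>pverts K - {y K}. ?\<gamma> (r K p) * g (r K p)) =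
        (\<Sum>p\<in>pverts K - {y K}. \<beta> K p * g (r K p))"
      using the_owner[OF K] notin_H[OF K]
      by (intro sum.cong) (auto simp: glue_weight_def relocate_def)
    then show ?thesis
      using F(3)[OF K] y_in[OF K] by (simp add: sum.remove[of "pverts K" "y K"])
  qed
  then have "(\<Sum>v\<in>pverts G. ?\<gamma> v * g v) = (\<Sum>v\<in>pverts H. ?\<gamma> v * g v) +
      (\<Sum>K\<in>F. (\<Sum>p\<in>pverts K. \<beta> K p * g (r K p)) - \<beta> K (y K) * g (x K))"
    by (simp add: sum_glue)
  also have "(\<Sum>v\<in>pverts H. ?\<gamma> v * g v) =
      (\<Sum>v\<in>pverts H. \<alpha> v * g v) + (\<Sum>K\<in>F. \<beta> K (y K) * g (x K))"
    by (simp add: glue_weight_def distrib_right sum.distrib sum_attached_mult cong: sum.cong)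
  finally show ?thesis by (simp add: sum_subtractf)
qed

section \<open>Distance sums of the glued graph\<close>

definition total_dist :: "'a \<Rightarrow> real" where "total_dist v = (\<Sum>u\<in>pverts G. graph_dist G v u)"

text \<open>For \<open>K\<close> in \<open>F\<close>, by symmetry of distances, the moment of
  \<open>K\<close> at \<open>y K\<close> for the constant weight 1.\<close>

definition root_dist :: "'a pair_pre_digraph \<Rightarrow> real" where
  "root_dist K = (\<Sum>q\<in>pverts K. graph_dist K (y K) q)"

text \<open>Split the vertices into the copy of \<open>K\<close> and the rest. By
  \<open>dist_cut\<close>, each vertex of the rest is farther from \<open>r K p\<close> than from
  \<open>x K\<close> by the same amount \<open>graph_dist K p (y K)\<close>.\<close>

lemma total_dist_relocate:
  assumes K: "K \<in> F" and p: "p \<in> pverts K"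
  shows "total_dist (r K p) = (\<Sum>q\<in>pverts K. graph_dist K p q)
    + (real (card (pverts G)) - real (card (pverts K))) * graph_dist K p (y K) + total_dist (x K) - root_dist K"
proof -
  let ?R = "r K ` pverts K"
  have sub: "?R \<subseteq> pverts G" using relocate_in[OF K] by auto
  have split: "total_dist v = (\<Sum>u\<in>pverts G - ?R. graph_dist G v u) + (\<Sum>q\<in>pverts K. graph_dist G v (r K q))" for v
    unfolding total_dist_def using sum.subset_diff[OF sub finite_G]
    by (simp add: sum.reindex[OF inj_relocate[OF K]])
  \<comment> \<open>The same split at \<open>x K\<close> eliminates the unknown sum over the
    rest.\<close>
  have base: "total_dist (x K) = (\<Sum>u\<in>pverts G - ?R. graph_dist G (x K) u) + root_dist K"
    using split[of "x K"] dist_relocate[OF K y_in[OF K]] by (simp add: root_dist_def)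
  have "total_dist (r K p) = (\<Sum>u\<in>pverts G - ?R. graph_dist K p (y K) + graph_dist G (x K) u)
      + (\<Sum>q\<in>pverts K. graph_dist K p q)"
    unfolding split using dist_relocate[OF K p] dist_cut[OF K p] by simp
  also have "real (card (pverts G - ?R)) = real (card (pverts G)) - real (card (pverts K))"
    using card_mono[OF finite_G sub] finite_G sub
    by (simp add: card_Diff_subset finite_subset of_nat_diff card_image[OF inj_relocate[OF K]])
  ultimately show ?thesis using base by (simp add: sum.distrib)
qed

text \<open>The distance from \<open>v\<close> into a copy is the distance to \<open>x K\<close>
  plus the distance from \<open>y K\<close> inside \<open>K\<close>. The factor is
  \<open>card (pverts K) - 1\<close> because \<open>x K\<close> is counted in
  \<open>H\<close>.\<close>

lemma total_dist_H:
  assumes v: "v \<in> pverts H"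
  shows "total_dist v = (\<Sum>u\<in>pverts H. graph_dist H v u)
    + (\<Sum>K\<in>F. (real (card (pverts K)) - 1) * graph_dist H v (x K) + root_dist K)"
proof -
  have vG: "v \<in> pverts G" using v pverts_H_subset by auto
  have "(\<Sum>q\<in>pverts K. graph_dist G v (r K q)) = card (pverts K) * graph_dist H v (x K) + root_dist K"
    if K: "K \<in> F" for K
  proof -
    interpret K: connected_sym_digraph K by (rule F(2)[OF K])
    have "graph_dist G v (r K q) = graph_dist H v (x K) + graph_dist K (y K) q"
      if q: "q \<in> pverts K" for q
    \<comment> \<open>\<open>x K\<close> belongs to the copy, so \<open>dist_cut\<close> covers only
      the other vertices of \<open>H\<close>.\<close>
    proof (cases "v = x K")
      case True
      then show ?thesis
        using dist_relocate[OF K y_in[OF K] q] H.graph_dist_self[OF v] by simp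
    next
      case False
      then have "v \<notin> r K ` pverts K"
        using v notin_H[OF K] by (auto simp: relocate_def split: if_splits)
      then have "graph_dist G (r K q) v = graph_dist K q (y K) + graph_dist G (x K) v"
        using dist_cut[OF K q] vG by simp
      then show ?thesis
        using G.graph_dist_sym[OF vG relocate_in[OF K q]] K.graph_dist_sym[OF q y_in[OF K]]
          G.graph_dist_sym[OF base_in[OF K] vG] dist_H[OF v x_in[OF K]] by simp
    qed
    then show ?thesis by (simp add: sum.distrib root_dist_def)
  qed
  then show ?thesis
    unfolding total_dist_def sum_glue using v dist_H x_in by (simp add: algebra_simps)
qed

lemma moment_glue: "moment G \<rho> = (\<Sum>v\<in>pverts G. \<rho> v * total_dist v)"
  unfolding moment_def moment_at_def total_dist_def sum_distrib_left by (rule sum.swap)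

end

section \<open>Collecting the terms of the moment\<close>

theorem theorem4p1:
  fixes H :: "'a pair_pre_digraph"
    and F :: "'a pair_pre_digraph set"
    and \<alpha> :: "'a \<Rightarrow> real"
    and \<beta> :: "'a pair_pre_digraph \<Rightarrow> 'a \<Rightarrow> real"
    and x y :: "'a pair_pre_digraph \<Rightarrow> 'a"
    and G :: "'a pair_pre_digraph"
    and \<gamma> n w j :: "'a \<Rightarrow> real"
    and A W :: real
    and B :: "'a pair_pre_digraph \<Rightarrow> real"
    and D :: "'a \<Rightarrow> 'a \<Rightarrow> real"
    and \<xi> :: "'a \<Rightarrow> 'a \<Rightarrow> real"
    and \<eta> :: "'a pair_pre_digraph \<Rightarrow> 'a \<Rightarrow> real"
  assumes H: "pair_graph H" "Digraph_Component.connected (with_proj H)"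
    and \<alpha>_nonneg: "\<And>v. v \<in> pverts H \<Longrightarrow> 0 \<le> \<alpha> v"
    and F_finite: "finite F"
    and F_graphs: "\<And>K. K \<in> F \<Longrightarrow> pair_graph K"
      "\<And>K. K \<in> F \<Longrightarrow> Digraph_Component.connected (with_proj K)"
    and F_disjoint: "disjoint_family_on pverts F"
    and F_disjoint_H: "\<And>K. K \<in> F \<Longrightarrow> pverts K \<inter> pverts H = {}"
    and \<beta>_nonneg: "\<And>K v. K \<in> F \<Longrightarrow> v \<in> pverts K \<Longrightarrow> 0 \<le> \<beta> K v"
    and y_in: "\<And>K. K \<in> F \<Longrightarrow> y K \<in> pverts K"
    and x_in: "\<And>K. K \<in> F \<Longrightarrow> x K \<in> pverts H"
  defines "G \<equiv> glue H F x y"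
    and "\<gamma> \<equiv> glue_weight H F x y \<alpha> \<beta>"
    and "A \<equiv> \<Sum>u\<in>pverts H. \<alpha> u"
    and "B \<equiv> \<lambda>K. \<Sum>v\<in>pverts K. \<beta> K v"
    and "n \<equiv> \<lambda>v. (\<Sum>K\<in>attached F x v. real (card (pverts K))) - real (card (attached F x v)) + 1"
    and "w \<equiv> \<lambda>v. \<Sum>K\<in>attached F x v. B K"
    and "W \<equiv> A + (\<Sum>K\<in>F. B K)"
    and "j \<equiv> \<lambda>v. 1"
    and "D \<equiv> graph_dist H"
    and "\<xi> \<equiv> \<lambda>v u. (n v - 1) * \<alpha> u + w v"
    and "\<eta> \<equiv> \<lambda>K u. (real (card (pverts G)) - real (card (pverts K))) * \<beta> K u + W - B K"
  shows "moment G \<gamma> =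
      moment H \<alpha> + (\<Sum>K\<in>F. moment K (\<beta> K))
      + (\<Sum>v\<in>pverts H. moment_at H (\<xi> v) v)
      + (\<Sum>K\<in>F. moment_at K (\<eta> K) (y K))
      + dot_on (pverts H) (\<lambda>v. n v - j v) (mat_vec_on (pverts H) D w)"
proof -
  have graphs: "connected_sym_digraph K" "finite (pverts K)" if "K \<in> F" for K
  proof -
    interpret pair_graph K by (rule F_graphs(1)[OF that])
    show "connected_sym_digraph K" "finite (pverts K)"
      using connected_sym_digraphI F_graphs that pair_finite_verts by auto
  qed
  have H': "connected_sym_digraph H" "finite (pverts H)"
  proof -
    interpret pair_graph H by (rule H(1))
    show "connected_sym_digraph H" "finite (pverts H)"
      using connected_sym_digraphI H pair_finite_verts by auto
  qed
  interpret gluing H F x y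
    by (rule gluing.intro) (fact H' graphs F_finite F_disjoint F_disjoint_H y_in x_in)+
  define k where "k K = real (card (pverts K))" for K :: "'a pair_pre_digraph"
  \<comment> \<open>The moment of \<open>H\<close> at \<open>u\<close> for the constant weight 1; it
    carries the constant part of \<open>\<xi>\<close>.\<close>
  define M1 where "M1 u = (\<Sum>v\<in>pverts H. graph_dist H v u)" for u
  let ?M\<alpha> = "moment_at H \<alpha>"

  \<comment> \<open>The \<open>\<alpha>\<close> mass yields the moment of \<open>H\<close>, the
    \<open>\<alpha>\<close> part of \<open>\<xi>\<close>, and the summand \<open>A\<close> of
    \<open>W\<close> in \<open>\<eta>\<close>.\<close>
  have H_part: "(\<Sum>v\<in>pverts H. \<alpha> v * total_dist v) =
      moment H \<alpha> + (\<Sum>K\<in>F. (k K - 1) * ?M\<alpha> (x K)) + A * (\<Sum>K\<in>F. root_dist K)"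
  proof -
    have "(\<Sum>v\<in>pverts H. \<alpha> v * total_dist v) =
        (\<Sum>v\<in>pverts H. \<Sum>u\<in>pverts H. \<alpha> v * graph_dist H v u)
        + (\<Sum>v\<in>pverts H. \<Sum>K\<in>F. (k K - 1) * (\<alpha> v * graph_dist H v (x K)) + \<alpha> v * root_dist K)"
      by (simp add: total_dist_H k_def distrib_left sum_distrib_left sum.distrib mult_ac)
    also have "(\<Sum>v\<in>pverts H. \<Sum>u\<in>pverts H. \<alpha> v * graph_dist H v u) = moment H \<alpha>"
      unfolding moment_def moment_at_def by (rule sum.swap)
    also have "(\<Sum>v\<in>pverts H. \<Sum>K\<in>F. (k K - 1) * (\<alpha> v * graph_dist H v (x K)) + \<alpha> v * root_dist K) =
        (\<Sum>K\<in>F. (k K - 1) * ?M\<alpha> (x K) + A * root_dist K)"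
      by (subst sum.swap)
        (simp add: moment_at_def A_def sum.distrib sum_distrib_left sum_distrib_right)
    finally show ?thesis by (simp add: sum.distrib sum_distrib_left)
  qed

  \<comment> \<open>\<open>total_dist (x K)\<close> stays unexpanded; the last term supplies the
    \<open>- B K\<close> in \<open>\<eta>\<close>.\<close>
  have K_part: "(\<Sum>p\<in>pverts K. \<beta> K p * total_dist (relocate x y K p)) =
      moment K (\<beta> K) + (real (card (pverts G)) - k K) * moment_at K (\<beta> K) (y K)
      + B K * total_dist (x K) - B K * root_dist K" if K: "K \<in> F" for K
  proof -
    let ?N = "real (card (pverts G)) - k K"
    have "(\<Sum>p\<in>pverts K. \<beta> K p * total_dist (relocate x y K p)) =
        (\<Sum>p\<in>pverts K. (\<Sum>q\<in>pverts K. \<beta> K p * graph_dist K p q)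
          + ?N * (\<beta> K p * graph_dist K p (y K)) + \<beta> K p * total_dist (x K) - \<beta> K p * root_dist K)"
      by (rule sum.cong) (simp_all add: total_dist_relocate K G_def k_def sum_distrib_left algebra_simps)
    also have "\<dots> = (\<Sum>p\<in>pverts K. \<Sum>q\<in>pverts K. \<beta> K p * graph_dist K p q)
        + ?N * moment_at K (\<beta> K) (y K) + B K * total_dist (x K) - B K * root_dist K"
      by (simp add: sum.distrib sum_subtractf moment_at_def B_def sum_distrib_left sum_distrib_right)
    also have "(\<Sum>p\<in>pverts K. \<Sum>q\<in>pverts K. \<beta> K p * graph_dist K p q) = moment K (\<beta> K)"
      unfolding moment_def moment_at_def by (rule sum.swap)
    finally show ?thesis .
  qed

  have total_dist_base: "total_dist (x K) =
      M1 (x K) + (\<Sum>L\<in>F. (k L - 1) * graph_dist H (x L) (x K)) + (\<Sum>L\<in>F. root_dist L)" if K: "K \<in> F" for K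
    using total_dist_H[OF x_in[OF K]] H.graph_dist_sym[OF x_in[OF K]] x_in
    by (simp add: M1_def k_def sum.distrib)

  \<comment> \<open>\<open>n v - 1\<close> counts the new vertices that the graphs attached at
    \<open>v\<close> bring along.\<close>
  have n_eq: "n v - 1 = (\<Sum>K\<in>attached F x v. k K - 1)" for v
    by (simp add: n_def k_def sum_subtractf)

  have \<xi>_part: "(\<Sum>v\<in>pverts H. moment_at H (\<xi> v) v) =
      (\<Sum>K\<in>F. (k K - 1) * ?M\<alpha> (x K)) + (\<Sum>K\<in>F. B K * M1 (x K))"
  proof -
    have "moment_at H (\<xi> v) v = (n v - 1) * ?M\<alpha> v + w v * M1 v" for v
      by (simp add: moment_at_def \<xi>_def M1_def sum_distrib_left sum.distrib distrib_right mult.assoc)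
    then show ?thesis
      by (simp add: sum.distrib n_eq w_def sum_attached_mult)
  qed

  have \<eta>_part: "moment_at K (\<eta> K) (y K) =
      (real (card (pverts G)) - k K) * moment_at K (\<beta> K) (y K) + (W - B K) * root_dist K" if K: "K \<in> F" for K
  proof -
    interpret K: connected_sym_digraph K by (rule graphs(1)[OF K])
    have "root_dist K = (\<Sum>q\<in>pverts K. graph_dist K q (y K))"
      unfolding root_dist_def using K.graph_dist_sym y_in[OF K] by (intro sum.cong) auto
    then show ?thesis
      by (simp add: moment_at_def \<eta>_def k_def sum_distrib_left sum.distrib sum_subtractf
          distrib_right left_diff_distrib mult.assoc)
  qed

  \<comment> \<open>The bilinear form becomes a sum over pairs: \<open>L\<close> comes from
    \<open>n - j\<close>, \<open>K\<close> from \<open>w\<close>. The order of summation is chosen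
    to match the expansion of \<open>total_dist (x K)\<close>.\<close>
  have dot_part: "dot_on (pverts H) (\<lambda>v. n v - j v) (mat_vec_on (pverts H) D w) =
      (\<Sum>K\<in>F. B K * (\<Sum>L\<in>F. (k L - 1) * graph_dist H (x L) (x K)))"
  proof -
    have "mat_vec_on (pverts H) D w s = (\<Sum>K\<in>F. B K * graph_dist H s (x K))" for s
      using sum_attached_mult[of B "graph_dist H s"]
      by (simp add: mat_vec_on_def D_def w_def mult.commute)
    then have "dot_on (pverts H) (\<lambda>v. n v - j v) (mat_vec_on (pverts H) D w) =
        (\<Sum>L\<in>F. (k L - 1) * (\<Sum>K\<in>F. B K * graph_dist H (x L) (x K)))"
      by (simp add: dot_on_def j_def n_eq sum_attached_mult)
    also have "\<dots> = (\<Sum>L\<in>F. \<Sum>K\<in>F. B K * ((k L - 1) * graph_dist H (x L) (x K)))"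
      by (simp add: sum_distrib_left mult.left_commute)
    also have "\<dots> = (\<Sum>K\<in>F. B K * (\<Sum>L\<in>F. (k L - 1) * graph_dist H (x L) (x K)))"
      by (subst sum.swap) (simp add: sum_distrib_left)
    finally show ?thesis .
  qed

  have "moment G \<gamma> = (\<Sum>v\<in>pverts H. \<alpha> v * total_dist v) +
      (\<Sum>K\<in>F. \<Sum>p\<in>pverts K. \<beta> K p * total_dist (relocate x y K p))"
    by (simp add: G_def \<gamma>_def moment_glue sum_glue_weight)
  \<comment> \<open>The three summands go to the \<open>w\<close> part of \<open>\<xi>\<close>, to
    the matrix term, and, joined with \<open>A\<close>, to \<open>W\<close> in
    \<open>\<eta>\<close>.\<close>
  moreover have "(\<Sum>K\<in>F. B K * total_dist (x K)) = (\<Sum>K\<in>F. B K * M1 (x K))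
      + (\<Sum>K\<in>F. B K * (\<Sum>L\<in>F. (k L - 1) * graph_dist H (x L) (x K)))
      + (\<Sum>K\<in>F. B K) * (\<Sum>L\<in>F. root_dist L)"
    by (simp add: total_dist_base distrib_left sum.distrib sum_distrib_right)
  moreover have "(\<Sum>K\<in>F. (W - B K) * root_dist K) = W * (\<Sum>K\<in>F. root_dist K) - (\<Sum>K\<in>F. B K * root_dist K)"
    by (simp add: left_diff_distrib sum_subtractf sum_distrib_left)
  ultimately show ?thesis
    by (simp add: H_part K_part \<xi>_part \<eta>_part dot_part W_def sum.distrib sum_subtractf distrib_right)
qed

end
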